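(* For all sufficiently large $n$, the logarithmic volumes $v(B_n)$ of the braid group $B_n$ and $v(B_n^{+})$ of the semigroup of positive braids $B_n^+$ satisfy $$\tfrac12\log 7<v(B_n)\le\log 7,\qquad \log 2<v(B_n^{+})\le\log 4 .$$
   Context: $B_n$ is the Artin braid group with generators $\sigma_1,\dots,\sigma_{n-1}$ and relations $\sigma_i\sigma_{i+1}\sigma_i=\sigma_{i+1}\sigma_i\sigma_{i+1}$ ($1\le i<n-1$) and $\sigma_i\sigma_j=\sigma_j\sigma_i$ ($|i-j|\ge2$); $B_n^{+}$ is the semigroup (monoid) with the same generators and relations. The length of an element is the minimal length of a word representing it, in the letters $\sigma_i^{\pm1}$ for $B_n$ and in the letters $\sigma_i$ for $B_n^+$. For $G=B_n$ or $B_n^+$, the logarithmic volume is $v(G)=\lim_{K\to\infty}\frac{\log V(G,K)}{K}$, where $V(G,K)$ is the number of elements of $G$ of length $K$. *)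

theory Defs
  imports Complex_Main "HOL-Algebra.Group"
begin

inductive word_cong :: "'a set \<Rightarrow> ('a list \<times> 'a list) set \<Rightarrow> 'a list \<Rightarrow> 'a list \<Rightarrow> bool"
  for A R where
  refl: "w \<in> lists A \<Longrightarrow> word_cong A R w w"
| rel: "\<lbrakk>(l, r) \<in> R; l \<in> lists A; r \<in> lists A; u \<in> lists A; v \<in> lists A\<rbrakk>
    \<Longrightarrow> word_cong A R (u @ l @ v) (u @ r @ v)"
| sym: "word_cong A R x y \<Longrightarrow> word_cong A R y x"
| trans: "\<lbrakk>word_cong A R x y; word_cong A R y z\<rbrakk> \<Longrightarrow> word_cong A R x z"

definition word_rel :: "'a set \<Rightarrow> ('a list \<times> 'a list) set \<Rightarrow> 'a list rel" where
  "word_rel A R = {(x, y). word_cong A R x y}"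

text \<open>An element of the presented monoid is the set of all words over \<open>A\<close> representing it.\<close>

definition presented_monoid :: "'a set \<Rightarrow> ('a list \<times> 'a list) set \<Rightarrow> 'a list set monoid" where
  "presented_monoid A R =
    \<lparr>carrier = lists A // word_rel A R,
     mult = (\<lambda>X Y. \<Union>x\<in>X. \<Union>y\<in>Y. word_rel A R `` {x @ y}),
     one = word_rel A R `` {[]}\<rparr>"

text \<open>The letter \<open>(a, True)\<close> stands for the generator \<open>a\<close> and \<open>(a, False)\<close> for its inverse. The
  relations \<open>R\<close> are between positive words.\<close>

definition group_relations ::
  "'a set \<Rightarrow> ('a list \<times> 'a list) set \<Rightarrow> (('a \<times> bool) list \<times> ('a \<times> bool) list) set" where
  "group_relations A R =
    {(map (\<lambda>a. (a, True)) l, map (\<lambda>a. (a, True)) r) | l r. (l, r) \<in> R} \<union>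
    {([(a, e), (a, \<not> e)], []) | a e. a \<in> A}"

definition presented_group ::
  "'a set \<Rightarrow> ('a list \<times> 'a list) set \<Rightarrow> ('a \<times> bool) list set monoid" where
  "presented_group A R = presented_monoid (A \<times> UNIV) (group_relations A R)"

definition braid_relations :: "nat \<Rightarrow> (nat list \<times> nat list) set" where
  "braid_relations n =
    {([i, i + 1, i], [i + 1, i, i + 1]) | i. 1 \<le> i \<and> i + 1 < n} \<union>
    {([i, j], [j, i]) | i j. i \<in> {1..<n} \<and> j \<in> {1..<n} \<and> \<bar>int i - int j\<bar> \<ge> 2}"

definition braid_group :: "nat \<Rightarrow> (nat \<times> bool) list set monoid" where
  "braid_group n = presented_group {1..<n} (braid_relations n)"

definition braid_monoid :: "nat \<Rightarrow> nat list set monoid" where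
  "braid_monoid n = presented_monoid {1..<n} (braid_relations n)"

definition min_length :: "'a list set \<Rightarrow> nat" where
  "min_length X = (LEAST k. \<exists>w\<in>X. length w = k)"

definition volume :: "'a list set monoid \<Rightarrow> nat \<Rightarrow> nat" where
  "volume G K = card {X \<in> carrier G. min_length X = K}"

definition log_growth :: "'a list set monoid \<Rightarrow> nat \<Rightarrow> real" where
  "log_growth G K = ln (real (volume G K)) / real K"

definition log_volume :: "'a list set monoid \<Rightarrow> real" where
  "log_volume G = lim (log_growth G)"

lemma word_cong_lists:
  assumes "word_cong A R x y" shows "x \<in> lists A \<and> y \<in> lists A"
  using assms by induction auto

lemma equiv_word_rel: "equiv (lists A) (word_rel A R)"
proof (rule equivI)
  show "word_rel A R \<subseteq> lists A \<times> lists A"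
    by (auto simp: word_rel_def dest: word_cong_lists)
  show "refl_on (lists A) (word_rel A R)"
    by (auto simp: refl_on_def word_rel_def intro: word_cong.refl)
  show "sym (word_rel A R)"
    by (auto simp: sym_def word_rel_def intro: word_cong.sym)
  show "trans (word_rel A R)"
    unfolding trans_def word_rel_def by (auto intro: word_cong.trans)
qed

lemma word_cong_context:
  assumes "word_cong A R x y" "u \<in> lists A" "v \<in> lists A"
  shows "word_cong A R (u @ x @ v) (u @ y @ v)"
  using assms
proof induction
  case (refl w)
  then show ?case by (intro word_cong.refl) auto
next
  case (rel l r u' v')
  then show ?case
    using word_cong.rel[of l r R A "u @ u'" "v' @ v"] by simp
next
  case (sym x y)
  then show ?case by (blast intro: word_cong.sym)
next
  case (trans x y z)
  then show ?case by (blast intro: word_cong.trans)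
qed

lemma word_cong_append:
  assumes "word_cong A R x x'" "word_cong A R y y'"
  shows "word_cong A R (x @ y) (x' @ y')"
proof -
  have "word_cong A R (x @ y) (x' @ y)"
    using word_cong_context[OF assms(1), of "[]" y] word_cong_lists[OF assms(2)] by simp
  moreover have "word_cong A R (x' @ y) (x' @ y')"
    using word_cong_context[OF assms(2), of x' "[]"] word_cong_lists[OF assms(1)] by simp
  ultimately show ?thesis by (rule word_cong.trans)
qed

lemma presented_mult_class:
  assumes "x \<in> lists A" "y \<in> lists A"
  shows "word_rel A R `` {x} \<otimes>\<^bsub>presented_monoid A R\<^esub> word_rel A R `` {y} = word_rel A R `` {x @ y}"
proof -
  have "word_rel A R `` {x' @ y'} = word_rel A R `` {x @ y}"
    if "word_cong A R x x'" "word_cong A R y y'" for x' y'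
    using equiv_class_eq[OF equiv_word_rel, of "x @ y" "x' @ y'" A R] word_cong_append[OF that]
    by (simp add: word_rel_def)
  then have "word_rel A R `` {x' @ y'} = word_rel A R `` {x @ y}"
    if "x' \<in> word_rel A R `` {x}" "y' \<in> word_rel A R `` {y}" for x' y'
    using that by (simp add: word_rel_def)
  moreover have "x \<in> word_rel A R `` {x}" "y \<in> word_rel A R `` {y}"
    using assms by (simp_all only: equiv_class_self[OF equiv_word_rel])
  ultimately show ?thesis
    unfolding presented_monoid_def monoid.simps by blast
qed

lemma presented_carrier_class:
  assumes "X \<in> carrier (presented_monoid A R)"
  obtains x where "x \<in> lists A" "X = word_rel A R `` {x}"
proof -
  have "X \<in> lists A // word_rel A R" using assms by (simp add: presented_monoid_def)
  then show ?thesis using that by (rule quotientE)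
qed

lemma class_in_presented_carrier:
  "x \<in> lists A \<Longrightarrow> word_rel A R `` {x} \<in> carrier (presented_monoid A R)"
  by (simp add: presented_monoid_def quotientI)

lemma presented_one: "\<one>\<^bsub>presented_monoid A R\<^esub> = word_rel A R `` {[]}"
  by (simp add: presented_monoid_def)

lemma monoid_presented_monoid: "monoid (presented_monoid A R)"
proof (rule monoidI, goal_cases)
  case (1 X Y)
  obtain x where x: "x \<in> lists A" "X = word_rel A R `` {x}"
    using 1(1) by (rule presented_carrier_class)
  obtain y where y: "y \<in> lists A" "Y = word_rel A R `` {y}"
    using 1(2) by (rule presented_carrier_class)
  have "x @ y \<in> lists A" using x y by simp
  then show ?case
    using x y by (simp only: presented_mult_class class_in_presented_carrier)
next
  case 2
  then show ?case by (simp add: presented_one class_in_presented_carrier)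
next
  case (3 X Y Z)
  obtain x where x: "x \<in> lists A" "X = word_rel A R `` {x}"
    using 3(1) by (rule presented_carrier_class)
  obtain y where y: "y \<in> lists A" "Y = word_rel A R `` {y}"
    using 3(2) by (rule presented_carrier_class)
  obtain z where z: "z \<in> lists A" "Z = word_rel A R `` {z}"
    using 3(3) by (rule presented_carrier_class)
  have "x @ y \<in> lists A" "y @ z \<in> lists A" using x y z by auto
  then show ?case using x y z by (simp only: presented_mult_class append_assoc)
next
  case (4 X)
  then obtain x where "x \<in> lists A" "X = word_rel A R `` {x}"
    by (rule presented_carrier_class)
  then show ?case using presented_mult_class[of "[]" A x R] by (simp add: presented_one)
next
  case (5 X)
  then obtain x where "x \<in> lists A" "X = word_rel A R `` {x}"
    by (rule presented_carrier_class)
  then show ?case using presented_mult_class[of x A "[]" R] by (simp add: presented_one)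
qed

lemma group_presented_group: "group (presented_group A R)"
proof -
  let ?A = "A \<times> (UNIV :: bool set)" and ?R = "group_relations A R"
  let ?G = "presented_monoid ?A ?R"
  interpret monoid ?G by (rule monoid_presented_monoid)
  have inv: "\<exists>y\<in>lists ?A. word_cong ?A ?R (y @ x) []" if "x \<in> lists ?A" for x
    using that
  proof induction
    case Nil
    then show ?case by (auto intro!: bexI[of _ "[]"] word_cong.refl)
  next
    case (Cons p x)
    obtain a e where p: "p = (a, e)" "a \<in> A" using Cons by auto
    obtain y where y: "y \<in> lists ?A" "word_cong ?A ?R (y @ x) []" using Cons by blast
    have "([(a, \<not> e), (a, e)], []) \<in> ?R"
      using p by (force simp: group_relations_def)
    then have "word_cong ?A ?R (y @ [(a, \<not> e), (a, e)] @ x) (y @ [] @ x)"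
      using p y Cons by (intro word_cong.rel) auto
    then have "word_cong ?A ?R ((y @ [(a, \<not> e)]) @ p # x) []"
      using y p word_cong.trans by fastforce
    moreover have "y @ [(a, \<not> e)] \<in> lists ?A" using y p by auto
    ultimately show ?case by blast
  qed
  have "\<exists>Y\<in>carrier ?G. Y \<otimes>\<^bsub>?G\<^esub> X = \<one>\<^bsub>?G\<^esub>" if X: "X \<in> carrier ?G" for X
  proof -
    obtain x where x: "x \<in> lists ?A" "X = word_rel ?A ?R `` {x}"
      using X by (rule presented_carrier_class)
    obtain y where y: "y \<in> lists ?A" "word_cong ?A ?R (y @ x) []"
      using inv x by blast
    have "word_rel ?A ?R `` {y @ x} = word_rel ?A ?R `` {[]}"
      using y by (intro equiv_class_eq[OF equiv_word_rel]) (simp add: word_rel_def)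
    then have "word_rel ?A ?R `` {y} \<otimes>\<^bsub>?G\<^esub> X = \<one>\<^bsub>?G\<^esub>"
      using x y by (simp only: presented_mult_class presented_one)
    then show ?thesis using class_in_presented_carrier[OF y(1)] by blast
  qed
  then have "group ?G"
    by (intro groupI) (auto simp: m_assoc)
  then show ?thesis by (simp add: presented_group_def)
qed

lemma group_braid_group: "group (braid_group n)"
  by (simp add: braid_group_def group_presented_group)

lemma monoid_braid_monoid: "monoid (braid_monoid n)"
  by (simp add: braid_monoid_def monoid_presented_monoid)

end

theory Submission
  imports Defs
begin

text \<open>Volumes are submultiplicative, so the limits exist by Fekete's lemma, and a lower bound on the
  number of elements that are products of at most \<open>K\<close> generators bounds the limit from below.

  Upper bounds: only commutation and free cancellation are used. A shortest word can be arranged so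
  that a letter \<open>i\<close> is followed only by letters \<open>j \<ge> i - 1\<close> (and never by its inverse); a weight
  vector of the transfer matrix shows that there are \<open>O(4 ^ K)\<close> resp. \<open>O(7 ^ K)\<close> such words.

  Lower bound for the group: in the integral Burau representation at \<open>-1\<close>, in a suitable basis, the
  generators \<open>\<sigma>\<^sub>2, \<sigma>\<^sub>4, \<dots>\<close> and the inverses of \<open>\<sigma>\<^sub>1, \<sigma>\<^sub>3, \<dots>\<close> act by nonnegative matrices, and the
  image of the vector of ones determines the word up to commutations. So these elements satisfy no
  other relations; already four of them give growth \<open>3 > sqrt 7\<close>.

  Lower bound for the monoid: to a positive word in which all letters come in runs of length at
  least two the relation \<open>\<sigma>\<^sub>i \<sigma>\<^sub>j \<sigma>\<^sub>i = \<sigma>\<^sub>j \<sigma>\<^sub>i \<sigma>\<^sub>j\<close> never applies, so such words are equivalent only by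
  commutations and are told apart by the same vectors; on five letters their growth exceeds
  \<open>41 / 20\<close>.\<close>

section \<open>Growth of submultiplicative sequences\<close>

text \<open>The limit is the infimum \<open>L\<close>: write \<open>n = q * m + r\<close> with
  \<open>a m / m\<close> close to \<open>L\<close>; the remainder term is bounded and vanishes after
  division by \<open>n\<close>.\<close>

lemma fekete_convergent:
  fixes a :: "nat \<Rightarrow> real"
  assumes sub: "\<And>m n. a (m + n) \<le> a m + a n" and nonneg: "\<And>n. 0 \<le> a n"
  shows "convergent (\<lambda>n. a n / real n)"
proof -
  define L where "L = (INF n\<in>{1..}. a n / real n)"
  have bdd: "bdd_below ((\<lambda>n. a n / real n) ` {1..})"
    by (rule bdd_belowI[of _ 0]) (auto simp: nonneg)
  have ge: "L \<le> a n / real n" if "n \<ge> 1" for n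
    unfolding L_def using that by (intro cINF_lower bdd) auto
  have mult: "a (q * m + r) \<le> real q * a m + a r" for q m r
  proof (induction q)
    case (Suc q)
    have "a (Suc q * m + r) \<le> a m + a (q * m + r)"
      using sub[of m "q * m + r"] by (simp add: algebra_simps)
    also have "\<dots> \<le> real (Suc q) * a m + a r"
      using Suc by (simp add: algebra_simps)
    finally show ?case .
  qed simp
  have "(\<lambda>n. a n / real n) \<longlonglongrightarrow> L"
  proof (rule LIMSEQ_I)
    fix e :: real assume "e > 0"
    then have "\<exists>m\<in>{1..}. a m / real m < L + e / 2"
      using cINF_less_iff[OF _ bdd, of "L + e / 2"] by (auto simp: L_def)
    then obtain m where m: "m \<ge> 1" "a m / real m < L + e / 2" by auto
    define M where "M = (\<Sum>r<m. a r)"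
    have M: "a r \<le> M" if "r < m" for r
      unfolding M_def using that by (intro member_le_sum) (auto simp: nonneg)
    obtain N :: nat where N: "2 * M / e < real N" using reals_Archimedean2 by blast
    have "norm (a n / real n - L) < e" if n: "n \<ge> max 1 N" for n
    proof -
      have "a n \<le> real (n div m) * a m + a (n mod m)"
        using mult[of "n div m" m "n mod m"] by simp
      also have "\<dots> \<le> real n / real m * a m + M"
        using m M[of "n mod m"] of_nat_div_le_of_nat[of n m, where 'a=real] nonneg[of m]
        by (intro add_mono mult_right_mono) auto
      finally have "a n / real n \<le> a m / real m + M / real n"
        using n m by (simp add: field_simps)
      moreover have "M / real n < e / 2"
      proof -
        have "2 * M / e < real n" using N n by linarith
        then show ?thesis using \<open>e > 0\<close> n by (simp add: field_simps)
      qed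
      ultimately have "a n / real n < L + e" using m by linarith
      then show ?thesis using \<open>e > 0\<close> ge[of n] n by (simp add: abs_less_iff)
    qed
    then show "\<exists>N. \<forall>n\<ge>N. norm (a n / real n - L) < e" by blast
  qed
  then show ?thesis by (rule convergentI)
qed

text \<open>The lower bound concerns balls, not spheres: inequivalent words of one length may still
  have shorter representatives.\<close>

locale exponential_growth =
  fixes V :: "nat \<Rightarrow> nat" and c \<beta> :: real
  assumes submult: "V (K + L) \<le> V K * V L"
    and ball: "c * \<beta> ^ K \<le> real (\<Sum>j\<le>K. V j)"
    and c: "c > 0" and \<beta>: "\<beta> > 1"
begin

lemma positive: "V K > 0"
proof (rule ccontr)
  assume "\<not> V K > 0"
  \<comment> \<open>Submultiplicativity makes every larger sphere empty too, so the balls would stop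
    growing.\<close>
  then have zero: "V j = 0" if "j \<ge> K" for j
    using submult[of K "j - K"] that by simp
  define B where "B = real (\<Sum>j\<le>K. V j)"
  obtain m where m: "B / c < \<beta> ^ m" using real_arch_pow[OF \<beta>] by blast
  have "\<beta> ^ m \<le> \<beta> ^ (max m K)" using \<beta> by (intro power_increasing) auto
  then have "B < c * \<beta> ^ (max m K)"
    using m c by (auto simp: field_simps intro: less_le_trans)
  also have "\<dots> \<le> real (\<Sum>j\<le>max m K. V j)" by (rule ball)
  also have "(\<Sum>j\<le>max m K. V j) = (\<Sum>j\<le>K. V j)"
    using zero by (intro sum.mono_neutral_right) auto
  finally show False by (simp add: B_def)
qed

lemma ln_nonneg: "0 \<le> ln (real (V K))"
  using positive[of K] by (intro ln_ge_zero) linarith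

lemma convergent_log: "convergent (\<lambda>K. ln (real (V K)) / real K)"
proof (rule fekete_convergent)
  fix m n
  have "real (V (m + n)) \<le> real (V m) * real (V n)"
    using submult[of m n] by (metis of_nat_le_iff of_nat_mult)
  then have "ln (real (V (m + n))) \<le> ln (real (V m) * real (V n))"
    using positive by simp
  then show "ln (real (V (m + n))) \<le> ln (real (V m)) + ln (real (V n))"
    using positive[of m] positive[of n] by (simp add: ln_mult)
qed (rule ln_nonneg)

lemma tendsto_log: "(\<lambda>K. ln (real (V K)) / real K) \<longlonglongrightarrow> lim (\<lambda>K. ln (real (V K)) / real K)"
  using convergent_log by (simp add: convergent_LIMSEQ_iff)

text \<open>A limit below \<open>ln \<beta>\<close> would bound the spheres eventually by
  \<open>\<rho> ^ j\<close> with \<open>\<rho> < \<beta>\<close>; the balls would then be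
  \<open>O(K * \<rho> ^ K)\<close>, too small for \<open>ball\<close>.\<close>

lemma lim_log_ge: "ln \<beta> \<le> lim (\<lambda>K. ln (real (V K)) / real K)"
proof (rule ccontr)
  define v where "v = lim (\<lambda>K. ln (real (V K)) / real K)"
  assume "\<not> ?thesis"
  then have "v < ln \<beta>" by (simp add: v_def)
  then obtain r where r: "v < r" "r < ln \<beta>" using dense by blast
  have "v \<ge> 0"
    unfolding v_def using tendsto_log
    by (rule LIMSEQ_le_const) (intro exI allI impI divide_nonneg_nonneg ln_nonneg of_nat_0_le_iff)
  define \<rho> where "\<rho> = exp r"
  have \<rho>: "\<rho> \<ge> 1" "\<rho> < \<beta>"
    using r \<open>v \<ge> 0\<close> \<beta> by (auto simp: \<rho>_def exp_less_cancel_iff[of r "ln \<beta>", symmetric]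
        simp del: exp_less_cancel_iff)
  have "eventually (\<lambda>K. ln (real (V K)) / real K < r) sequentially"
    using order_tendstoD(2)[OF tendsto_log] r by (simp add: v_def)
  then obtain K0 where K0: "\<And>K. K \<ge> K0 \<Longrightarrow> ln (real (V K)) / real K < r"
    by (auto simp: eventually_sequentially)
  have V: "real (V j) \<le> \<rho> ^ j" if "j \<ge> Suc K0" for j
  proof -
    have "ln (real (V j)) < real j * r"
      using K0[of j] that by (simp add: field_simps)
    then have "exp (ln (real (V j))) \<le> exp (real j * r)" by simp
    then show ?thesis using positive[of j] by (simp add: \<rho>_def exp_of_nat_mult)
  qed
  define B where "B = real (\<Sum>j\<le>K0. V j)"
  have sum: "real (\<Sum>j\<le>K. V j) \<le> B + (real K + 1) * \<rho> ^ K" for K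
  proof -
    have "real (\<Sum>j\<le>K. V j) \<le> (\<Sum>j\<le>K. (if j \<le> K0 then real (V j) else 0) + \<rho> ^ K)"
    proof -
      have "real (V j) \<le> (if j \<le> K0 then real (V j) else 0) + \<rho> ^ K" if "j \<le> K" for j
        using V[of j] power_increasing[OF that \<rho>(1)] \<rho>(1) by (auto simp: not_le)
      then show ?thesis by (simp only: of_nat_sum) (intro sum_mono, simp)
    qed
    also have "\<dots> = (\<Sum>j\<in>{..K} \<inter> {..K0}. real (V j)) + (real K + 1) * \<rho> ^ K"
      using sum.inter_restrict[of "{..K}" "\<lambda>j. real (V j)" "{..K0}"]
      by (simp add: sum.distrib algebra_simps del: Int_atMost)
    also have "(\<Sum>j\<in>{..K} \<inter> {..K0}. real (V j)) \<le> B"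
      unfolding B_def of_nat_sum by (intro sum_mono2) auto
    finally show ?thesis by simp
  qed
  have "c \<le> B * (1 / \<beta>) ^ K + (real K * (\<rho> / \<beta>) ^ K + (\<rho> / \<beta>) ^ K)" for K
  proof -
    have "c * \<beta> ^ K \<le> B + (real K + 1) * \<rho> ^ K" using ball[of K] sum[of K] by linarith
    then show ?thesis using \<beta> by (simp add: field_simps)
  qed
  moreover have "(\<lambda>K. B * (1 / \<beta>) ^ K + (real K * (\<rho> / \<beta>) ^ K + (\<rho> / \<beta>) ^ K))
      \<longlonglongrightarrow> B * 0 + (0 + 0)"
    using \<beta> \<rho> by (intro tendsto_intros powser_times_n_limit_0 LIMSEQ_power_zero) auto
  ultimately have "c \<le> B * 0 + (0 + 0)" by (intro LIMSEQ_le_const) auto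
  then show False using c by simp
qed

lemma lim_log_le:
  assumes "\<And>K. real (V (Suc K)) \<le> C * \<mu> ^ K" "C > 0" "\<mu> > 0"
  shows "lim (\<lambda>K. ln (real (V K)) / real K) \<le> ln \<mu>"
proof -
  have "ln (real (V (Suc K))) / real (Suc K) \<le> ln (C / \<mu>) * (1 / real (Suc K)) + ln \<mu>" for K
  proof -
    have "ln (real (V (Suc K))) \<le> ln (C / \<mu> * \<mu> ^ Suc K)"
      using assms positive[of "Suc K"] by (intro ln_mono) (auto simp: field_simps)
    also have "\<dots> = ln (C / \<mu>) + real (Suc K) * ln \<mu>"
      using assms by (subst ln_mult) (auto simp del: power_Suc simp: ln_realpow)
    finally have "ln (real (V (Suc K))) / real (Suc K)
        \<le> (ln (C / \<mu>) + real (Suc K) * ln \<mu>) / real (Suc K)"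
      by (rule divide_right_mono) simp
    then show ?thesis by (simp add: add_divide_distrib del: of_nat_Suc)
  qed
  moreover have "(\<lambda>K. ln (C / \<mu>) * (1 / real (Suc K)) + ln \<mu>) \<longlonglongrightarrow> ln (C / \<mu>) * 0 + ln \<mu>"
    by (intro tendsto_intros LIMSEQ_Suc lim_1_over_n)
  ultimately show ?thesis
    using LIMSEQ_le[OF LIMSEQ_Suc[OF tendsto_log]] by fastforce
qed

end

section \<open>Counting words by their consecutive letters\<close>

text \<open>The letter \<open>a\<close> precedes the word and is not part of it. For
  \<open>a\<close> in \<open>A\<close> the cardinality is a row sum of the \<open>K\<close>-th power
  of the transfer matrix of \<open>P\<close>.\<close>

definition walks :: "('a \<Rightarrow> 'a \<Rightarrow> bool) \<Rightarrow> 'a set \<Rightarrow> nat \<Rightarrow> 'a \<Rightarrow> 'a list set" where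
  "walks P A K a = {w \<in> lists A. length w = K \<and> successively P (a # w)}"

lemma finite_words: "finite A \<Longrightarrow> finite {w \<in> lists A. length w = K}"
  using finite_lists_length_eq[of A K] by (simp add: lists_eq_set)

lemma finite_walks: "finite A \<Longrightarrow> finite (walks P A K a)"
  by (rule finite_subset[OF _ finite_words[of A K]]) (auto simp: walks_def)

lemma walks_Suc: "walks P A (Suc K) a = (\<Union>b\<in>{b \<in> A. P a b}. (#) b ` walks P A K b)"
proof (rule Set.set_eqI)
  fix w
  show "w \<in> walks P A (Suc K) a \<longleftrightarrow> w \<in> (\<Union>b\<in>{b \<in> A. P a b}. (#) b ` walks P A K b)"
    by (cases w) (auto simp: walks_def)
qed

lemma card_walks_0: "card (walks P A 0 a) = 1"
proof -
  have "walks P A 0 a = {[]}" by (auto simp: walks_def)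
  then show ?thesis by simp
qed

lemma card_walks_Suc:
  assumes "finite A"
  shows "card (walks P A (Suc K) a) = (\<Sum>b\<in>{b \<in> A. P a b}. card (walks P A K b))"
  unfolding walks_Suc using assms
  by (subst card_UN_disjoint) (auto simp: finite_walks card_image)

text \<open>Iterate the transfer matrix on the subeigenvector \<open>h\<close>, then compare
  \<open>h\<close> with \<open>M\<close> times the vector of ones.\<close>

lemma card_walks_ge:
  fixes h :: "'a \<Rightarrow> real"
  assumes "finite A" "\<And>a. a \<in> A \<Longrightarrow> \<beta> * h a \<le> (\<Sum>b\<in>{b \<in> A. P a b}. h b)"
    "\<And>a. a \<in> A \<Longrightarrow> h a \<le> M" "\<beta> \<ge> 0" "a \<in> A"
  shows "\<beta> ^ K * h a \<le> M * real (card (walks P A K a))"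
  using \<open>a \<in> A\<close>
proof (induction K arbitrary: a)
  case 0
  then show ?case using assms by (simp add: card_walks_0)
next
  case (Suc K)
  have "\<beta> ^ Suc K * h a \<le> \<beta> ^ K * (\<Sum>b\<in>{b \<in> A. P a b}. h b)"
    using mult_left_mono[OF assms(2)[OF Suc.prems], of "\<beta> ^ K"] assms(4) by (simp add: algebra_simps)
  also have "\<dots> \<le> (\<Sum>b\<in>{b \<in> A. P a b}. M * real (card (walks P A K b)))"
    unfolding sum_distrib_left by (intro sum_mono Suc.IH) auto
  also have "\<dots> = M * real (card (walks P A (Suc K) a))"
    using assms by (simp add: card_walks_Suc sum_distrib_left)
  finally show ?case .
qed

text \<open>The same iteration with a supereigenvector that is bounded below.\<close>

lemma card_walks_le:
  fixes h :: "'a \<Rightarrow> real"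
  assumes "finite A" "\<And>a. a \<in> A \<Longrightarrow> (\<Sum>b\<in>{b \<in> A. P a b}. h b) \<le> \<mu> * h a"
    "\<And>a. a \<in> A \<Longrightarrow> m \<le> h a" "\<mu> \<ge> 0" "a \<in> A"
  shows "m * real (card (walks P A K a)) \<le> \<mu> ^ K * h a"
  using \<open>a \<in> A\<close>
proof (induction K arbitrary: a)
  case 0
  then show ?case using assms by (simp add: card_walks_0)
next
  case (Suc K)
  have "m * real (card (walks P A (Suc K) a)) = (\<Sum>b\<in>{b \<in> A. P a b}. m * real (card (walks P A K b)))"
    using assms by (simp add: card_walks_Suc sum_distrib_left)
  also have "\<dots> \<le> \<mu> ^ K * (\<Sum>b\<in>{b \<in> A. P a b}. h b)"
    unfolding sum_distrib_left by (intro sum_mono Suc.IH) auto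
  also have "\<dots> \<le> \<mu> ^ Suc K * h a"
    using mult_left_mono[OF assms(2)[OF Suc.prems], of "\<mu> ^ K"] assms(4) by (simp add: algebra_simps)
  finally show ?case .
qed

lemma not_successivelyE:
  assumes "\<not> successively P w"
  obtains u a b v where "w = u @ [a, b] @ v" "\<not> P a b"
proof -
  have "\<exists>u a b v. w = u @ [a, b] @ v \<and> \<not> P a b"
    using assms
  proof (induction w)
    case (Cons x w)
    then obtain y w' where w: "w = y # w'" by (cases w) auto
    show ?case
    proof (cases "P x y")
      case True
      then obtain u a b v where "w = u @ [a, b] @ v" "\<not> P a b"
        using Cons w by auto
      then show ?thesis by (intro exI[of _ "x # u"]) auto
    next
      case False
      then show ?thesis using w by (intro exI[of _ "[]"]) auto
    qed
  qed simp
  then show ?thesis using that by blast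
qed

section \<open>Volumes of presented monoids\<close>

lemma word_rel_iff [simp]: "(x, y) \<in> word_rel A R \<longleftrightarrow> word_cong A R x y"
  by (simp add: word_rel_def)

lemma mem_class: "y \<in> word_rel A R `` {x} \<longleftrightarrow> word_cong A R x y"
  by simp

lemma class_eq: "word_cong A R x y \<Longrightarrow> word_rel A R `` {x} = word_rel A R `` {y}"
  by (intro equiv_class_eq[OF equiv_word_rel]) (simp add: word_rel_def)

lemma min_length_le: "w \<in> X \<Longrightarrow> min_length X \<le> length w"
  unfolding min_length_def by (rule Least_le) blast

lemma min_length_class_le: "x \<in> lists A \<Longrightarrow> min_length (word_rel A R `` {x}) \<le> length x"
  by (rule min_length_le) (simp add: word_cong.refl)

lemma carrier_minimal_word:
  assumes "X \<in> carrier (presented_monoid A R)"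
  obtains w where "w \<in> lists A" "length w = min_length X" "X = word_rel A R `` {w}"
proof -
  obtain x where x: "x \<in> lists A" "X = word_rel A R `` {x}"
    using assms by (rule presented_carrier_class)
  then have "x \<in> X" by (simp add: word_cong.refl)
  then have "\<exists>k. \<exists>w\<in>X. length w = k" by blast
  then have "\<exists>w\<in>X. length w = min_length X"
    unfolding min_length_def by (rule LeastI_ex)
  then obtain w where w: "w \<in> X" "length w = min_length X" by blast
  then have "word_cong A R x w" using x by simp
  then show ?thesis
    using that[of w] w x class_eq word_cong_lists by metis
qed

definition sphere :: "'a set \<Rightarrow> ('a list \<times> 'a list) set \<Rightarrow> nat \<Rightarrow> 'a list set set" where
  "sphere A R K = {X \<in> carrier (presented_monoid A R). min_length X = K}"

lemma volume_eq: "volume (presented_monoid A R) K = card (sphere A R K)"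
  by (simp add: volume_def sphere_def)

lemma finite_sphere:
  assumes "finite A" shows "finite (sphere A R K)"
proof (rule finite_subset)
  show "sphere A R K \<subseteq> (\<lambda>w. word_rel A R `` {w}) ` {w \<in> lists A. length w = K}"
  proof
    fix X assume "X \<in> sphere A R K"
    then show "X \<in> (\<lambda>w. word_rel A R `` {w}) ` {w \<in> lists A. length w = K}"
      by (auto simp: sphere_def elim!: carrier_minimal_word)
  qed
qed (simp add: finite_words[OF assms])

text \<open>A shorter representative of either factor would shorten the product.\<close>

lemma minimal_factors:
  assumes "u @ v \<in> lists A" "min_length (word_rel A R `` {u @ v}) = length u + length v"
  shows "min_length (word_rel A R `` {u}) = length u" "min_length (word_rel A R `` {v}) = length v"
proof -
  have uv: "u \<in> lists A" "v \<in> lists A" using assms by auto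
  obtain u' where u': "length u' = min_length (word_rel A R `` {u})" "word_cong A R u u'"
    using carrier_minimal_word[OF class_in_presented_carrier[OF uv(1)]]
    by (metis mem_class word_cong.refl)
  obtain v' where v': "length v' = min_length (word_rel A R `` {v})" "word_cong A R v v'"
    using carrier_minimal_word[OF class_in_presented_carrier[OF uv(2)]]
    by (metis mem_class word_cong.refl)
  have "length u + length v \<le> length u' + length v'"
    using min_length_le[of "u' @ v'" "word_rel A R `` {u @ v}"] word_cong_append[OF u'(2) v'(2)] assms
    by simp
  then show "min_length (word_rel A R `` {u}) = length u" "min_length (word_rel A R `` {v}) = length v"
    using u' v' min_length_class_le[OF uv(1), of R] min_length_class_le[OF uv(2), of R] by linarith+
qed

text \<open>Cutting a shortest word after \<open>K\<close> letters leaves two shortest words, so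
  every element of the larger sphere is a product from the two smaller ones.\<close>

lemma volume_submult:
  assumes "finite A"
  shows "volume (presented_monoid A R) (K + L)
    \<le> volume (presented_monoid A R) K * volume (presented_monoid A R) L"
proof -
  let ?f = "\<lambda>(U, V). U \<otimes>\<^bsub>presented_monoid A R\<^esub> V"
  have "sphere A R (K + L) \<subseteq> ?f ` (sphere A R K \<times> sphere A R L)"
  proof
    fix X assume "X \<in> sphere A R (K + L)"
    then have X: "X \<in> carrier (presented_monoid A R)" "min_length X = K + L"
      by (auto simp: sphere_def)
    then obtain w where w: "w \<in> lists A" "length w = K + L" "X = word_rel A R `` {w}"
      using carrier_minimal_word[OF X(1)] by metis
    define u v where "u = take K w" and "v = drop K w"
    have uv: "w = u @ v" "length u = K" "length v = L"
      using w by (auto simp: u_def v_def)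
    then have uv': "u \<in> lists A" "v \<in> lists A" using w by auto
    have "word_rel A R `` {u} \<in> sphere A R K" "word_rel A R `` {v} \<in> sphere A R L"
      using minimal_factors[of u v A R] w X uv class_in_presented_carrier[OF uv'(1)] class_in_presented_carrier[OF uv'(2)]
      by (simp_all add: sphere_def)
    moreover have "X = ?f (word_rel A R `` {u}, word_rel A R `` {v})"
      using presented_mult_class[OF uv'] uv w by simp
    ultimately show "X \<in> ?f ` (sphere A R K \<times> sphere A R L)" by blast
  qed
  then have "card (sphere A R (K + L)) \<le> card (sphere A R K \<times> sphere A R L)"
    by (rule surj_card_le[rotated]) (simp add: finite_sphere[OF assms])
  then show ?thesis by (simp add: volume_eq card_cartesian_product)
qed

lemma card_le_sum_volume:
  assumes "finite A" "W \<subseteq> lists A" "\<And>w. w \<in> W \<Longrightarrow> length w \<le> K"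
    "\<And>x y. x \<in> W \<Longrightarrow> y \<in> W \<Longrightarrow> word_cong A R x y \<Longrightarrow> x = y"
  shows "card W \<le> (\<Sum>j\<le>K. volume (presented_monoid A R) j)"
proof -
  have "inj_on (\<lambda>w. word_rel A R `` {w}) W"
  proof (rule inj_onI)
    fix x y assume xy: "x \<in> W" "y \<in> W" "word_rel A R `` {x} = word_rel A R `` {y}"
    then have "word_cong A R x y"
      using assms(2) by (metis mem_class subsetD word_cong.refl)
    then show "x = y" using assms(4) xy by blast
  qed
  moreover have "(\<lambda>w. word_rel A R `` {w}) ` W \<subseteq> (\<Union>j\<le>K. sphere A R j)"
  proof (rule image_subsetI)
    fix w assume w: "w \<in> W"
    then have "w \<in> lists A" using assms(2) by blast
    then have "min_length (word_rel A R `` {w}) \<le> K"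
      "word_rel A R `` {w} \<in> carrier (presented_monoid A R)"
      using min_length_class_le[of w A R] assms(3)[OF w] class_in_presented_carrier[of w A R] by auto
    then show "word_rel A R `` {w} \<in> (\<Union>j\<le>K. sphere A R j)"
      by (simp add: sphere_def)
  qed
  ultimately have "card W \<le> card (\<Union>j\<le>K. sphere A R j)"
    by (intro card_inj_on_le) (auto simp: finite_sphere assms)
  also have "\<dots> \<le> (\<Sum>j\<le>K. volume (presented_monoid A R) j)"
    unfolding volume_eq by (rule card_UN_le) simp
  finally show ?thesis .
qed

text \<open>The shift to length \<open>Suc K\<close> leaves room for a fixed first letter before a
  walk of length \<open>K\<close> and costs a factor \<open>\<beta>\<close>; the cap at
  \<open>1\<close> covers radius \<open>0\<close>, where only the empty word is counted.\<close>

lemma exponential_growth_volume: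
  assumes "finite A" "\<And>K. c * \<beta> ^ K \<le> real (card (W K))" "c > 0" "\<beta> > 1"
    "\<And>K. W K \<subseteq> {w \<in> lists A. length w = Suc K}"
    "\<And>K x y. x \<in> W K \<Longrightarrow> y \<in> W K \<Longrightarrow> word_cong A R x y \<Longrightarrow> x = y"
  shows "exponential_growth (volume (presented_monoid A R)) (min (c / \<beta>) 1) \<beta>"
proof
  let ?V = "volume (presented_monoid A R)"
  show "?V (K + L) \<le> ?V K * ?V L" for K L
    by (rule volume_submult) fact
  show "min (c / \<beta>) 1 * \<beta> ^ K \<le> real (\<Sum>j\<le>K. ?V j)" for K
  proof (cases K)
    case 0
    have "card {[] :: 'a list} \<le> (\<Sum>j\<le>K. ?V j)"
      using assms(1) by (rule card_le_sum_volume) auto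
    then show ?thesis using 0 by simp
  next
    case (Suc k)
    have "min (c / \<beta>) 1 * \<beta> ^ K \<le> c / \<beta> * \<beta> ^ K"
      using assms by (intro mult_right_mono) auto
    also have "\<dots> = c * \<beta> ^ k" using assms Suc by simp
    also have "\<dots> \<le> real (card (W k))" by fact
    also have "card (W k) \<le> (\<Sum>j\<le>K. ?V j)"
      using assms(5)[of k] assms(6)[of _ k] Suc
      by (intro card_le_sum_volume[OF assms(1)]) auto
    finally show ?thesis by simp
  qed
qed (use assms(3,4) in auto)

text \<open>Among the shortest words of a class pick one minimising the sum of the ranks weighted by
  position from the right end; every forbidden pair could be cancelled or swapped to decrease it.\<close>

lemma minimal_word_successively:
  fixes rk :: "'a \<Rightarrow> nat"
  assumes X: "X \<in> carrier (presented_monoid A R)"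
    and rw: "\<And>a b. a \<in> A \<Longrightarrow> b \<in> A \<Longrightarrow> \<not> P a b \<Longrightarrow>
      word_cong A R [a, b] [] \<or> word_cong A R [a, b] [b, a] \<and> rk b < rk a"
  obtains w where "w \<in> lists A" "length w = min_length X" "X = word_rel A R `` {w}"
    "successively P w"
proof -
  define f where "f = rec_list 0 (\<lambda>a w n. rk a * Suc (length w) + n)"
  have f: "f (u @ w) = f u + length w * sum_list (map rk u) + f w" for u w
    by (induction u) (auto simp: f_def algebra_simps)
  define Q where "Q w \<longleftrightarrow> w \<in> lists A \<and> length w = min_length X \<and> X = word_rel A R `` {w}" for w
  obtain w0 where "Q w0" by (rule carrier_minimal_word[OF X]) (auto simp: Q_def)
  then obtain w where w: "Q w" "\<And>w'. Q w' \<Longrightarrow> f w \<le> f w'"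
    using ex_has_least_nat[of Q w0 f] by metis
  have "successively P w"
  proof (rule ccontr)
    assume "\<not> successively P w"
    then obtain u a b v where uv: "w = u @ [a, b] @ v" "\<not> P a b" by (rule not_successivelyE)
    have A: "a \<in> A" "b \<in> A" "u \<in> lists A" "v \<in> lists A" using w uv by (auto simp: Q_def)
    have mem: "X = word_rel A R `` {u @ z @ v}" "min_length X \<le> length (u @ z @ v)"
      if "word_cong A R [a, b] z" for z
    proof -
      have cong: "word_cong A R w (u @ z @ v)"
        using word_cong_context[OF that A(3,4)] uv by simp
      have X: "X = word_rel A R `` {w}" using w(1) by (simp add: Q_def)
      with cong show "X = word_rel A R `` {u @ z @ v}" by (simp add: class_eq)
      show "min_length X \<le> length (u @ z @ v)"
        using cong X by (intro min_length_le) simp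
    qed
    from rw[OF A(1,2) uv(2)] show False
    proof
      assume "word_cong A R [a, b] []"
      then show False using mem(2)[of "[]"] w uv by (auto simp: Q_def)
    next
      assume swap: "word_cong A R [a, b] [b, a] \<and> rk b < rk a"
      then have "Q (u @ [b, a] @ v)"
        using mem(1)[of "[b, a]"] w uv A by (auto simp: Q_def)
      then have "f w \<le> f (u @ [b, a] @ v)" by (rule w)
      \<comment> \<open>The swap lowers \<open>f\<close> by exactly
        \<open>rk a - rk b\<close>.\<close>
      then show False using swap uv by (simp add: f) (simp add: f_def algebra_simps)
    qed
  qed
  then show ?thesis using that w by (auto simp: Q_def)
qed

lemma volume_le_walks:
  fixes rk :: "'a \<Rightarrow> nat" and h :: "'a \<Rightarrow> real"
  assumes A: "finite A"
    and rw: "\<And>a b. a \<in> A \<Longrightarrow> b \<in> A \<Longrightarrow> \<not> P a b \<Longrightarrow>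
      word_cong A R [a, b] [] \<or> word_cong A R [a, b] [b, a] \<and> rk b < rk a"
    and h: "\<And>a. a \<in> A \<Longrightarrow> (\<Sum>b\<in>{b \<in> A. P a b}. h b) \<le> \<mu> * h a" "\<And>a. a \<in> A \<Longrightarrow> h a > 0"
    and \<mu>: "\<mu> \<ge> 0"
  obtains C where "C > 0" "\<And>K. real (volume (presented_monoid A R) (Suc K)) \<le> C * \<mu> ^ K"
proof
  \<comment> \<open>The inserted \<open>1\<close> gives \<open>Min\<close> a nonempty set even for
    empty \<open>A\<close>; the summand \<open>1\<close> in \<open>?C\<close> likewise secures
    positivity.\<close>
  define m where "m = Min (insert 1 (h ` A))"
  have m: "m > 0" "\<And>a. a \<in> A \<Longrightarrow> m \<le> h a"
    using A h(2) by (auto simp: m_def)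
  let ?C = "(\<Sum>a\<in>A. h a) / m + 1"
  have nonneg: "0 \<le> (\<Sum>a\<in>A. h a)" by (intro sum_nonneg) (use h(2) less_imp_le in blast)
  then show "?C > 0" using m(1) by (simp add: add_nonneg_pos)
  fix K
  have "sphere A R (Suc K) \<subseteq> (\<lambda>w. word_rel A R `` {w}) ` (\<Union>a\<in>A. (#) a ` walks P A K a)"
  proof
    fix X assume X: "X \<in> sphere A R (Suc K)"
    then have "X \<in> carrier (presented_monoid A R)" by (simp add: sphere_def)
    then obtain w where w: "w \<in> lists A" "length w = min_length X" "X = word_rel A R `` {w}"
      "successively P w"
      using minimal_word_successively[of X A R P rk] rw by blast
    then obtain a w' where "w = a # w'" using X by (cases w) (auto simp: sphere_def)
    then have "w \<in> (\<Union>a\<in>A. (#) a ` walks P A K a)"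
      using w X by (auto simp: walks_def sphere_def)
    then show "X \<in> (\<lambda>w. word_rel A R `` {w}) ` (\<Union>a\<in>A. (#) a ` walks P A K a)"
      using w by blast
  qed
  then have "card (sphere A R (Suc K)) \<le> card (\<Union>a\<in>A. (#) a ` walks P A K a)"
    by (rule surj_card_le[rotated]) (simp add: A finite_walks)
  also have "\<dots> \<le> (\<Sum>a\<in>A. card ((#) a ` walks P A K a))" by (rule card_UN_le[OF A])
  also have "\<dots> = (\<Sum>a\<in>A. card (walks P A K a))" by (simp add: card_image)
  finally have "m * real (volume (presented_monoid A R) (Suc K))
      \<le> (\<Sum>a\<in>A. m * real (card (walks P A K a)))"
    unfolding volume_eq using m(1)
    by (simp add: sum_distrib_left[symmetric] of_nat_sum[symmetric] del: of_nat_sum)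
  also have "\<dots> \<le> (\<Sum>a\<in>A. \<mu> ^ K * h a)"
    using card_walks_le[OF A h(1) m(2) \<mu>] by (intro sum_mono) auto
  finally have "real (volume (presented_monoid A R) (Suc K)) \<le> (\<Sum>a\<in>A. h a) / m * \<mu> ^ K"
    using m(1) unfolding sum_distrib_left[symmetric] by (simp add: pos_le_divide_eq mult.commute)
  also have "\<dots> \<le> ?C * \<mu> ^ K" using \<mu> by (simp add: algebra_simps)
  finally show "real (volume (presented_monoid A R) (Suc K)) \<le> ?C * \<mu> ^ K" .
qed

section \<open>Artin relations and lower bounds\<close>

lemma foldr_word_cong:
  assumes "word_cong A R x y" "\<And>l r. (l, r) \<in> R \<Longrightarrow> foldr f l = foldr f r"
  shows "foldr f x = foldr f y"
  using assms by induction (auto simp: fun_eq_iff)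

text \<open>The Burau action at \<open>-1\<close> after a change of signs in the basis: a
  transvection in coordinate \<open>i\<close>, with sign alternating in the parity of
  \<open>i\<close>. Coordinate \<open>0\<close> and those beyond the last generator are never
  changed and act as a boundary.\<close>

fun twist :: "nat \<times> bool \<Rightarrow> (nat \<Rightarrow> int) \<Rightarrow> nat \<Rightarrow> int" where
  "twist (i, e) x = x(i := x i + (if e = even i then 1 else - 1) * (x (i - 1) + x (Suc i)))"

text \<open>Neighbouring generators carry opposite signs; with equal signs the relation would fail,
  as it does for \<open>bump\<close> below.\<close>

lemma twist_braid:
  assumes "i \<ge> 1"
  shows "twist (i, True) (twist (Suc i, True) (twist (i, True) x)) =
    twist (Suc i, True) (twist (i, True) (twist (Suc i, True) x))"
proof -
  have "i - 1 \<noteq> i" using assms by simp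
  then show ?thesis by (auto simp: fun_eq_iff)
qed

lemma twist_commute:
  assumes "\<bar>int i - int j\<bar> \<ge> 2" "i \<ge> 1" "j \<ge> 1"
  shows "twist (i, e) (twist (j, f) x) = twist (j, f) (twist (i, e) x)"
proof -
  have "i \<noteq> j" "i - 1 \<noteq> j" "Suc i \<noteq> j" "j - 1 \<noteq> i" "Suc j \<noteq> i" using assms by auto
  then show ?thesis by (simp add: fun_upd_twist[of i j])
qed

lemma twist_inverse: "i \<ge> 1 \<Longrightarrow> twist (i, e) (twist (i, \<not> e) x) = x"
  by (auto simp: fun_eq_iff)

lemma foldr_twist_group_cong:
  assumes "word_cong ({1..<n} \<times> UNIV) (group_relations {1..<n} (braid_relations n)) x y"
  shows "foldr twist x = foldr twist y"
  using assms
proof (rule foldr_word_cong)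
  fix l r assume "(l, r) \<in> group_relations {1..<n} (braid_relations n)"
  then consider i where "i \<ge> 1" "l = [(i, True), (Suc i, True), (i, True)]"
      "r = [(Suc i, True), (i, True), (Suc i, True)]"
    | i j where "i \<ge> 1" "j \<ge> 1" "\<bar>int i - int j\<bar> \<ge> 2"
      "l = [(i, True), (j, True)]" "r = [(j, True), (i, True)]"
    | i e where "i \<ge> 1" "l = [(i, e), (i, \<not> e)]" "r = []"
    unfolding group_relations_def braid_relations_def by auto
  then show "foldr twist l = foldr twist r"
  proof cases
    case 1
    then show ?thesis using twist_braid by (simp add: fun_eq_iff del: twist.simps)
  next
    case 2
    then show ?thesis using twist_commute by (simp add: fun_eq_iff del: twist.simps)
  next
    case 3
    then show ?thesis using twist_inverse by (simp add: fun_eq_iff del: twist.simps)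
  qed
qed

section \<open>Heights, which separate words up to commutation\<close>

definition bump :: "nat \<Rightarrow> (nat \<Rightarrow> int) \<Rightarrow> nat \<Rightarrow> int" where
  "bump i x = x(i := x (i - 1) + x i + x (Suc i))"

lemma twist_eq_bump: "twist (i, even i) = bump i"
  by (auto simp: bump_def fun_eq_iff)

lemma foldr_twist_eq_bump: "foldr twist (map (\<lambda>i. (i, even i)) w) = foldr bump w"
  by (induction w) (auto simp: twist_eq_bump simp del: twist.simps)

text \<open>Since \<open>foldr\<close> lets the first letter act last, the head of the word leaves a
  visible trace in the result.\<close>

definition height :: "nat list \<Rightarrow> nat \<Rightarrow> int" where
  "height w = foldr bump w (\<lambda>_. 1)"

lemma height_Nil: "height [] k = 1" by (simp add: height_def)

lemma height_Cons: "height (a # w) = bump a (height w)" by (simp add: height_def)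

lemma height_ge_1: "1 \<le> height w k"
proof (induction w arbitrary: k)
  case (Cons a w)
  show ?case using Cons[of k] Cons[of "k - 1"] Cons[of "Suc k"]
    by (auto simp: height_Cons bump_def)
qed (simp add: height_Nil)

lemma height_head: "a \<ge> 1 \<Longrightarrow> height (a # w) a > height (a # w) (a - 1) + height (a # w) (Suc a)"
  using height_ge_1[of w a] by (auto simp: height_Cons bump_def)

text \<open>A descent by two or more can be removed by a commutation, so these words serve as
  representatives modulo commutations.\<close>

abbreviation normal :: "nat list \<Rightarrow> bool" where
  "normal \<equiv> successively (\<lambda>i j. i \<le> Suc j)"

text \<open>The letter \<open>c\<close> after \<open>a\<close> satisfies
  \<open>c \<ge> a - 1\<close>, so by induction the heights already increase weakly up to
  \<open>a - 1\<close>; \<open>bump a\<close> changes only entry \<open>a\<close>, making it exceed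
  entry \<open>a - 1\<close>.\<close>

lemma height_below_head:
  "normal (a # w) \<Longrightarrow> b < a \<Longrightarrow> height (a # w) b \<le> height (a # w) (Suc b)"
proof (induction w arbitrary: a b)
  case Nil
  then show ?case by (auto simp: height_Cons height_Nil bump_def)
next
  case (Cons c w)
  show ?case
  proof (cases "Suc b = a")
    case True
    then show ?thesis
      using height_ge_1[of "c # w" a] height_ge_1[of "c # w" "Suc a"]
      by (auto simp: height_Cons[of a] bump_def)
  next
    case False
    then show ?thesis
      using Cons by (auto simp: height_Cons[of a] bump_def)
  qed
qed

lemma bump_inj: "a \<ge> 1 \<Longrightarrow> bump a x = bump a y \<Longrightarrow> x = y"
proof (rule ext)
  fix k assume a: "a \<ge> 1" and eq: "bump a x = bump a y"
  have off: "x k = y k" if "k \<noteq> a" for k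
    using fun_cong[OF eq, of k] that by (simp add: bump_def)
  then show "x k = y k"
    using fun_cong[OF eq, of a] off[of "a - 1"] off[of "Suc a"] a
    by (cases "k = a") (auto simp: bump_def)
qed

text \<open>The head of a normal word is the least index at which the height exceeds the sum of its two
  neighbours, so the height determines the word letter by letter.\<close>

lemma height_inj:
  "normal w \<Longrightarrow> normal w' \<Longrightarrow> 0 \<notin> set w \<Longrightarrow> 0 \<notin> set w' \<Longrightarrow> height w = height w' \<Longrightarrow> w = w'"
proof (induction w arbitrary: w')
  case Nil
  show ?case
  proof (cases w')
    case (Cons b v)
    then show ?thesis using height_head[of b v] Nil by (auto simp: height_Nil fun_eq_iff)
  qed simp
next
  case (Cons a w)
  have a: "a \<ge> 1" using Cons by auto
  obtain b v where w': "w' = b # v"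
  proof (cases w')
    case Nil
    then show ?thesis using height_head[OF a, of w] Cons(6) by (simp add: height_Nil)
  qed
  have b: "b \<ge> 1" using Cons w' by auto
  \<comment> \<open>At the head \<open>x\<close> the height exceeds the sum of both neighbours, but
    below the other head \<open>y\<close> it is at most its right neighbour.\<close>
  have not_less: False if "normal (y # w)" "x < y" "x \<ge> 1" "height (x # v) = height (y # w)" for x y v w
    using height_head[OF that(3), of v] height_below_head[OF that(1,2)]
      height_ge_1[of "y # w" "x - 1"] that(4) by simp
  have "a = b"
    using not_less[of b v a w] not_less[of a w b v] Cons.prems a b w' by (cases a b rule: linorder_cases) auto
  moreover have "w = v"
    using Cons.IH[of v] Cons.prems w' bump_inj[OF a] \<open>a = b\<close>
    by (auto simp: height_Cons successively_Cons)
  ultimately show ?case using w' by simp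
qed

lemma exponential_growth_braid_group:
  assumes "n \<ge> 5"
  shows "\<exists>c. exponential_growth (volume (braid_group n)) c 3"
proof -
  define P :: "nat \<Rightarrow> nat \<Rightarrow> bool" where "P i j \<longleftrightarrow> i \<le> Suc j" for i j
  define A :: "nat set" where "A = {1, 2, 3, 4}"
  \<comment> \<open>An exact eigenvector for the eigenvalue \<open>3\<close>: the row sums are 9, 9,
    6, 3. The entry at index \<open>0\<close> is a dummy.\<close>
  define h :: "nat \<Rightarrow> real" where "h i = [0, 3, 3, 2, 1] ! i" for i
  \<comment> \<open>Even letters occur as generators and odd ones as inverses, so that
    \<open>twist\<close> acts as \<open>bump\<close>.\<close>
  define W where "W K = (\<lambda>w. map (\<lambda>i. (i, even i)) (1 # w)) ` walks P A K 1" for K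
  have "3 ^ K * h 1 \<le> 3 * real (card (walks P A K 1))" for K
  proof (rule card_walks_ge)
    fix a assume "a \<in> A"
    then show "3 * h a \<le> (\<Sum>b\<in>{b \<in> A. P a b}. h b)"
      by (subst sum.inter_filter) (auto simp: A_def P_def h_def)
  qed (auto simp: A_def h_def)
  moreover have "card (W K) = card (walks P A K 1)" for K
    unfolding W_def by (intro card_image inj_onI) (auto simp: inj_map_eq_map inj_on_def)
  ultimately have card: "1 * 3 ^ K \<le> real (card (W K))" for K by (simp add: h_def)
  have "exponential_growth (volume (braid_group n)) (min (1 / 3) 1) 3"
    unfolding braid_group_def presented_group_def
  proof (rule exponential_growth_volume[where W = W])
    show "W K \<subseteq> {w \<in> lists ({1..<n} \<times> UNIV). length w = Suc K}" for K
      using assms by (fastforce simp: W_def walks_def A_def)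
  next
    fix K x y
    assume "x \<in> W K" "y \<in> W K"
      and cong: "word_cong ({1..<n} \<times> UNIV) (group_relations {1..<n} (braid_relations n)) x y"
    then obtain u v where uv: "u \<in> walks P A K 1" "v \<in> walks P A K 1"
      "x = map (\<lambda>i. (i, even i)) (1 # u)" "y = map (\<lambda>i. (i, even i)) (1 # v)"
      by (auto simp: W_def)
    have "foldr bump (1 # u) = foldr bump (1 # v)"
      using foldr_twist_group_cong[OF cong] unfolding uv foldr_twist_eq_bump .
    then have "height (1 # u) = height (1 # v)" unfolding height_def by simp
    then have "1 # u = 1 # v"
      using uv by (intro height_inj) (auto simp: walks_def P_def A_def)
    then show "x = y" using uv by simp
  qed (use card in auto)
  then show ?thesis by blast
qed

section \<open>Positive words with doubled letters\<close>

text \<open>Only the last run may have length one, so that a walk may stop in the middle of a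
  run.\<close>

inductive doubled :: "'a list \<Rightarrow> bool" where
  Nil: "doubled []"
| single: "doubled [x]"
| double: "doubled w \<Longrightarrow> doubled (x # x # w)"
| extend: "doubled (x # w) \<Longrightarrow> doubled (x # x # w)"

text \<open>Filtering deletes whole runs and can only merge the others.\<close>

lemma doubled_filter: "doubled w \<Longrightarrow> doubled (filter P w)"
  by (induction rule: doubled.induct) (auto intro: doubled.intros split: if_splits)

lemma doubled_no_isolated: "doubled w \<Longrightarrow> w = u @ [a, b, a] @ v \<Longrightarrow> a = b"
proof (induction arbitrary: u rule: doubled.induct)
  case (double w x)
  consider "u = []" | "u = [x]" | u' where "u = x # x # u'"
    using double.prems by (cases u; cases "tl u") auto
  then show ?case
  proof cases
    case 2
    then have "w = b # a # v" using double.prems by simp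
    then show ?thesis using double.hyps by (auto elim: doubled.cases)
  qed (use double in auto)
next
  case (extend x w)
  then show ?case by (cases u) auto
qed auto

text \<open>The pattern is forbidden in the projections to two neighbouring letters, because
  commutations can make a scattered occurrence contiguous.\<close>

definition aba_free :: "nat list \<Rightarrow> bool" where
  "aba_free w \<longleftrightarrow> (\<forall>k u a b v. filter (\<lambda>x. x = k \<or> x = Suc k) w = u @ [a, b, a] @ v \<longrightarrow> a = b)"

lemma doubled_aba_free: "doubled w \<Longrightarrow> aba_free w"
  unfolding aba_free_def by (intro allI impI) (rule doubled_no_isolated[OF doubled_filter])

lemma not_aba_free:
  "\<not> aba_free (u @ [i, Suc i, i] @ v)" "\<not> aba_free (u @ [Suc i, i, Suc i] @ v)"
proof -
  let ?f = "filter (\<lambda>x. x = i \<or> x = Suc i)"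
  have "?f (u @ [i, Suc i, i] @ v) = ?f u @ [i, Suc i, i] @ ?f v"
    "?f (u @ [Suc i, i, Suc i] @ v) = ?f u @ [Suc i, i, Suc i] @ ?f v" by auto
  moreover have "i \<noteq> Suc i" "Suc i \<noteq> i" by auto
  ultimately show "\<not> aba_free (u @ [i, Suc i, i] @ v)" "\<not> aba_free (u @ [Suc i, i, Suc i] @ v)"
    unfolding aba_free_def by blast+
qed

text \<open>Commuting distant letters does not change the projections to two neighbouring letters, hence
  the other braid relation is never applicable to a word equivalent to an \<open>aba\<close>-free one. This
  makes \<open>bump\<close> an invariant although it does not satisfy that relation.\<close>

lemma aba_free_cong:
  assumes "word_cong A (braid_relations n) x y"
  shows "(aba_free x \<longleftrightarrow> aba_free y) \<and> (aba_free x \<longrightarrow> foldr bump x = foldr bump y)"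
  using assms
proof induction
  case (rel l r u v)
  from rel(1) consider i where "l = [i, Suc i, i]" "r = [Suc i, i, Suc i]"
    | i j where "l = [i, j]" "r = [j, i]" "i \<ge> 1" "j \<ge> 1" "\<bar>int i - int j\<bar> \<ge> 2"
    unfolding braid_relations_def by auto
  then show ?case
  proof cases
    case 1
    then show ?thesis using not_aba_free[of u i v] by simp
  next
    case 2
    have "filter (\<lambda>x. x = k \<or> x = Suc k) (u @ l @ v) = filter (\<lambda>x. x = k \<or> x = Suc k) (u @ r @ v)" for k
      using 2 by auto
    then have "aba_free (u @ l @ v) \<longleftrightarrow> aba_free (u @ r @ v)"
      unfolding aba_free_def by simp
    moreover have "bump i (bump j x) = bump j (bump i x)" for x
      using 2 by (auto simp: bump_def fun_eq_iff)
    ultimately show ?thesis using 2(1,2) by (simp add: comp_def)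
  qed
qed auto

text \<open>The flag of a letter is set iff the preceding letter is the same one; a run may be left only
  at a flagged letter.\<close>

fun run_step :: "nat \<times> bool \<Rightarrow> nat \<times> bool \<Rightarrow> bool" where
  "run_step (i, e) (j, f) \<longleftrightarrow> (if j = i then f else e \<and> \<not> f \<and> i \<le> Suc j)"

text \<open>A set flag stands for a copy of \<open>i\<close> just before the word, which is restored
  here.\<close>

lemma run_step_doubled:
  "successively run_step ((i, e) # w) \<Longrightarrow> doubled ((if e then [i, i] else [i]) @ map fst w)"
proof (induction w arbitrary: i e)
  case Nil
  then show ?case by (auto intro: doubled.intros)
next
  case (Cons p w)
  then show ?case
    by (cases p) (fastforce intro: doubled.intros split: if_splits)
qed

lemma run_step_normal: "successively run_step w \<Longrightarrow> normal (map fst w)"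
  unfolding successively_map by (erule successively_mono) (auto split: if_splits)

text \<open>Given the starting state, the letters determine all flags, so counting flagged walks
  counts words.\<close>

lemma run_step_inj:
  "successively run_step (s # u) \<Longrightarrow> successively run_step (s # v) \<Longrightarrow> map fst u = map fst v \<Longrightarrow> u = v"
proof (induction u arbitrary: s v)
  case (Cons p u)
  obtain q v' where v: "v = q # v'" using Cons by (cases v) auto
  have "p = q" using Cons.prems v by (cases s; cases p; cases q) (auto split: if_splits)
  moreover have "u = v'"
    using Cons.IH[of q v'] Cons.prems v \<open>p = q\<close> by simp
  ultimately show ?case using v by simp
qed simp

lemma exponential_growth_braid_monoid:
  assumes "n \<ge> 6"
  shows "\<exists>c. exponential_growth (volume (braid_monoid n)) c (41 / 20)"
proof -
  define A :: "(nat \<times> bool) set" where "A = {1, 2, 3, 4, 5} \<times> UNIV"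
  \<comment> \<open>An unflagged state leads only to its flagged copy, whence the factor
    \<open>41 / 20\<close> in \<open>h\<close>. For flagged states, \<open>g\<close> is chosen so
    that \<open>(41 / 20) * (21 / 20) * g i\<close> is at most the sum of \<open>g j\<close> over
    \<open>j \<noteq> i\<close> with \<open>i \<le> Suc j\<close>.\<close>
  define g :: "nat \<Rightarrow> real" where "g i = [0, 12, 13, 9, 5, 2] ! i" for i
  define h :: "nat \<times> bool \<Rightarrow> real" where "h s = (if snd s then 41 / 20 else 1) * g (fst s)" for s
  define W where "W K = (\<lambda>w. 1 # map fst w) ` walks run_step A K (1, False)" for K
  \<comment> \<open>The largest value of \<open>h\<close> is
    \<open>41 / 20 * 13 < 27\<close>.\<close>
  have "(41 / 20) ^ K * h (1, False) \<le> 27 * real (card (walks run_step A K (1, False)))" for K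
  proof (rule card_walks_ge)
    fix a assume "a \<in> A"
    then obtain i e where a: "a = (i, e)" "i \<in> {1, 2, 3, 4, 5}" by (auto simp: A_def)
    have "(\<Sum>b\<in>{b \<in> A. run_step a b}. h b) =
        (\<Sum>j\<in>{1, 2, 3, 4, 5}. \<Sum>f\<in>UNIV. if run_step a (j, f) then h (j, f) else 0)"
      by (subst sum.inter_filter) (simp_all add: A_def sum.cartesian_product)
    then show "41 / 20 * h a \<le> (\<Sum>b\<in>{b \<in> A. run_step a b}. h b)"
      using a by (cases e) (auto simp: UNIV_bool h_def g_def)
  qed (auto simp: A_def h_def g_def)
  moreover have "card (W K) = card (walks run_step A K (1, False))" for K
    unfolding W_def by (intro card_image inj_onI) (auto simp: walks_def dest: run_step_inj)
  ultimately have card: "12 / 27 * (41 / 20) ^ K \<le> real (card (W K))" for K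
    by (simp add: h_def g_def mult.commute)
  have "exponential_growth (volume (braid_monoid n)) (min ((12 / 27) / (41 / 20)) 1) (41 / 20)"
    unfolding braid_monoid_def
  proof (rule exponential_growth_volume[where W = W])
    show "W K \<subseteq> {w \<in> lists {1..<n}. length w = Suc K}" for K
      using assms by (fastforce simp: W_def walks_def A_def)
  next
    fix K x y
    assume "x \<in> W K" "y \<in> W K" and cong: "word_cong {1..<n} (braid_relations n) x y"
    then obtain u v where uv: "u \<in> walks run_step A K (1, False)" "v \<in> walks run_step A K (1, False)"
      "x = 1 # map fst u" "y = 1 # map fst v"
      by (auto simp: W_def)
    have "aba_free x"
      using run_step_doubled[of 1 False u] uv by (intro doubled_aba_free) (simp add: walks_def)
    then have "height x = height y"
      using aba_free_cong[OF cong] by (simp add: height_def)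
    then show "x = y"
      using uv run_step_normal[of "(1, False) # u"] run_step_normal[of "(1, False) # v"]
      by (intro height_inj) (auto simp: walks_def A_def)
  qed (use card in auto)
  then show ?thesis by blast
qed

section \<open>Upper bounds\<close>

text \<open>The weight \<open>i / 2 ^ i\<close> is the eigenvector for the eigenvalue \<open>4\<close> of the transfer matrix of
  normal words on infinitely many letters.\<close>

lemma sum_weight: "k \<le> n \<Longrightarrow>
    (\<Sum>j\<in>{k..<n}. real j / 2 ^ j) = 2 * (real k + 1) / 2 ^ k - 2 * (real n + 1) / 2 ^ n"
proof (induction n rule: dec_induct)
  case (step m)
  have "real m / 2 ^ m = 2 * (real m + 1) / 2 ^ m - 2 * (real (Suc m) + 1) / 2 ^ Suc m"
    by (simp add: field_simps)
  then show ?case using step by simp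
qed simp

lemma sum_weight_le:
  assumes "i \<in> {1..<n}"
  shows "(\<Sum>j\<in>{j \<in> {1..<n}. i \<le> Suc j}. real j / 2 ^ j) \<le> 4 * (real i / 2 ^ i)"
proof -
  obtain k where k: "i = Suc k" using assms by (cases i) auto
  \<comment> \<open>For \<open>i = 1\<close> the range on the right also contains
    \<open>j = 0\<close>, whose weight is \<open>0\<close>.\<close>
  have "(\<Sum>j\<in>{j \<in> {1..<n}. i \<le> Suc j}. real j / 2 ^ j) = (\<Sum>j\<in>{k..<n}. real j / 2 ^ j)"
    using k by (intro sum.mono_neutral_left) auto
  also have "\<dots> \<le> 2 * (real k + 1) / 2 ^ k"
    using sum_weight[of k n] k assms by simp
  finally show ?thesis using k by (simp add: field_simps)
qed

lemma volume_braid_monoid_le: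
  obtains C where "C > 0" "\<And>K. real (volume (braid_monoid n) (Suc K)) \<le> C * 4 ^ K"
proof -
  have swap: "word_cong {1..<n} (braid_relations n) [i, j] [j, i]"
    if "i \<in> {1..<n}" "j \<in> {1..<n}" "\<not> i \<le> Suc j" for i j
    using word_cong.rel[of "[i, j]" "[j, i]" "braid_relations n" "{1..<n}" "[]" "[]"] that
    by (auto simp: braid_relations_def)
  show ?thesis
    by (rule volume_le_walks[of "{1..<n}" "\<lambda>i j. i \<le> Suc j" "braid_relations n" id
          "\<lambda>i. real i / 2 ^ i" 4])
      (use that sum_weight_le swap in \<open>auto simp: braid_monoid_def\<close>)
qed

text \<open>Insert a cancelling pair after \<open>q\<close>, commute the original letter past
  \<open>q\<close>, and cancel on the left.\<close>

lemma word_cong_commute_inverse: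
  fixes A R
  defines "cong \<equiv> word_cong (A \<times> UNIV) (group_relations A R)"
  assumes comm: "cong [(a, e), q] [q, (a, e)]"
  shows "cong [(a, \<not> e), q] [q, (a, \<not> e)]"
proof -
  have A: "a \<in> A" "q \<in> A \<times> UNIV"
    using word_cong_lists[OF comm[unfolded cong_def]] by auto
  have cancel: "cong (u @ [(a, f), (a, \<not> f)] @ v) (u @ [] @ v)"
    if "u \<in> lists (A \<times> UNIV)" "v \<in> lists (A \<times> UNIV)" for f u v
    unfolding cong_def using A that
    by (intro word_cong.rel) (auto simp: group_relations_def)
  have "cong [(a, \<not> e), q] [(a, \<not> e), q, (a, e), (a, \<not> e)]"
    using cancel[of "[(a, \<not> e), q]" "[]" e] A unfolding cong_def by (auto intro: word_cong.sym)
  moreover have "cong [(a, \<not> e), q, (a, e), (a, \<not> e)] [(a, \<not> e), (a, e), q, (a, \<not> e)]"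
    using word_cong_context[OF word_cong.sym[OF comm[unfolded cong_def]], of "[(a, \<not> e)]" "[(a, \<not> e)]"] A
    unfolding cong_def by auto
  moreover have "cong [(a, \<not> e), (a, e), q, (a, \<not> e)] [q, (a, \<not> e)]"
    using cancel[of "[]" "[q, (a, \<not> e)]" "\<not> e"] A by auto
  ultimately show ?thesis unfolding cong_def by (blast intro: word_cong.trans)
qed

lemma volume_braid_group_le:
  obtains C where "C > 0" "\<And>K. real (volume (braid_group n) (Suc K)) \<le> C * 7 ^ K"
proof -
  define P :: "nat \<times> bool \<Rightarrow> nat \<times> bool \<Rightarrow> bool" where
    "P p q \<longleftrightarrow> fst p \<le> Suc (fst q) \<and> (fst p = fst q \<longrightarrow> snd p = snd q)" for p q
  define h :: "nat \<times> bool \<Rightarrow> real" where "h p = real (fst p) / 2 ^ fst p" for p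
  let ?A = "{1..<n} \<times> (UNIV :: bool set)"
  let ?cong = "word_cong ?A (group_relations {1..<n} (braid_relations n))"
  have swap: "?cong [(i, e), (j, f)] [(j, f), (i, e)]"
    if ij: "i \<in> {1..<n}" "j \<in> {1..<n}" "\<not> i \<le> Suc j" for i j e f
  proof -
    have "([i, j], [j, i]) \<in> braid_relations n"
      using ij by (auto simp: braid_relations_def)
    then have "(map (\<lambda>a. (a, True)) [i, j], map (\<lambda>a. (a, True)) [j, i])
        \<in> group_relations {1..<n} (braid_relations n)"
      unfolding group_relations_def by blast
    then have "?cong [(i, True), (j, True)] [(j, True), (i, True)]"
      using word_cong.rel[of "[(i, True), (j, True)]" "[(j, True), (i, True)]" _ ?A "[]" "[]"] ij by auto
    \<comment> \<open>Commutation of the positive letters is carried over to inverses one letter at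
      a time.\<close>
    then have e: "?cong [(i, e), (j, True)] [(j, True), (i, e)]"
      using word_cong_commute_inverse[of "{1..<n}" "braid_relations n" i True] by (cases e) auto
    show ?thesis
      using e word_cong_commute_inverse[OF word_cong.sym[OF e]] by (cases f) (auto intro: word_cong.sym)
  qed
  have rw: "?cong [a, b] [] \<or> ?cong [a, b] [b, a] \<and> fst b < fst a"
    if ab: "a \<in> ?A" "b \<in> ?A" "\<not> P a b" for a b
  proof (cases "fst a \<le> Suc (fst b)")
    case True
    then have "b = (fst a, \<not> snd a)" using ab by (cases a; cases b) (auto simp: P_def)
    then have "([a, b], []) \<in> group_relations {1..<n} (braid_relations n)"
      using ab by (cases a) (auto simp: group_relations_def)
    then show ?thesis using word_cong.rel[of "[a, b]" "[]" _ ?A "[]" "[]"] ab by auto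
  next
    case False
    then show ?thesis using swap[of "fst a" "fst b" "snd a" "snd b"] ab by auto
  qed
  have sum: "(\<Sum>b\<in>{b \<in> ?A. P a b}. h b) \<le> 7 * h a" if "a \<in> ?A" for a
  proof -
    obtain i e where a: "a = (i, e)" "i \<in> {1..<n}" using \<open>a \<in> ?A\<close> by (rule SigmaE) auto
    have "(\<Sum>b\<in>{b \<in> ?A. P a b}. h b) = (\<Sum>j\<in>{1..<n}. \<Sum>f\<in>UNIV. if P a (j, f) then h (j, f) else 0)"
      by (subst sum.inter_filter) (simp_all add: sum.cartesian_product)
    \<comment> \<open>Two signs per index double the eigenvalue \<open>4\<close>; excluding the
      inverse of \<open>a\<close> subtracts \<open>h a\<close> once, which gives
      \<open>2 * 4 - 1 = 7\<close>.\<close>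
    also have "\<dots> = (\<Sum>j\<in>{1..<n}. 2 * (if i \<le> Suc j then real j / 2 ^ j else 0)
        - (if j = i then real j / 2 ^ j else 0))"
      using a by (intro sum.cong) (auto simp: UNIV_bool P_def h_def)
    also have "\<dots> = 2 * (\<Sum>j\<in>{j \<in> {1..<n}. i \<le> Suc j}. real j / 2 ^ j) - h a"
      using a by (simp add: sum_subtractf sum_distrib_left[symmetric] sum.inter_filter[symmetric] h_def
          del: mem_Collect_eq atLeastLessThan_iff)
    also have "\<dots> \<le> 7 * h a" using sum_weight_le[OF a(2)] a by (simp add: h_def)
    finally show ?thesis .
  qed
  show ?thesis
    by (rule volume_le_walks[of ?A P "group_relations {1..<n} (braid_relations n)" fst h 7])
      (use that rw sum in \<open>auto simp: braid_group_def presented_group_def h_def\<close>)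
qed

lemma log_growth_eq: "log_growth G = (\<lambda>K. ln (real (volume G K)) / real K)"
  by (simp add: log_growth_def fun_eq_iff)

theorem theorem8:
  "\<exists>N. \<forall>n\<ge>N.
     convergent (log_growth (braid_group n)) \<and>
     convergent (log_growth (braid_monoid n)) \<and>
     1 / 2 * ln 7 < log_volume (braid_group n) \<and> log_volume (braid_group n) \<le> ln 7 \<and>
     ln 2 < log_volume (braid_monoid n) \<and> log_volume (braid_monoid n) \<le> ln 4"
proof (intro exI allI impI)
  \<comment> \<open>The threshold makes all five letters of the monoid bound available.\<close>
  fix n :: nat assume n: "6 \<le> n"
  obtain c where "exponential_growth (volume (braid_group n)) c 3"
    using exponential_growth_braid_group[of n] n by auto
  then interpret G: exponential_growth "volume (braid_group n)" c 3 .
  obtain d where "exponential_growth (volume (braid_monoid n)) d (41 / 20)"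
    using exponential_growth_braid_monoid[of n] n by auto
  then interpret M: exponential_growth "volume (braid_monoid n)" d "41 / 20" .
  obtain C where C: "C > 0" "\<And>K. real (volume (braid_group n) (Suc K)) \<le> C * 7 ^ K"
    using volume_braid_group_le[of n] by blast
  obtain D where D: "D > 0" "\<And>K. real (volume (braid_monoid n) (Suc K)) \<le> D * 4 ^ K"
    using volume_braid_monoid_le[of n] by blast
  have "ln 7 < ln (3 ^ 2 :: real)" by simp
  also have "\<dots> = 2 * ln (3 :: real)" by (subst ln_realpow) simp
  finally have "1 / 2 * ln 7 < ln (3 :: real)" by simp
  moreover have "ln 2 < ln (41 / 20 :: real)" by (subst ln_less_cancel_iff) auto
  ultimately show "convergent (log_growth (braid_group n)) \<and>
     convergent (log_growth (braid_monoid n)) \<and>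
     1 / 2 * ln 7 < log_volume (braid_group n) \<and> log_volume (braid_group n) \<le> ln 7 \<and>
     ln 2 < log_volume (braid_monoid n) \<and> log_volume (braid_monoid n) \<le> ln 4"
    using G.convergent_log G.lim_log_ge G.lim_log_le[OF C(2) C(1)]
      M.convergent_log M.lim_log_ge M.lim_log_le[OF D(2) D(1)]
    unfolding log_volume_def log_growth_eq by linarith
qed

end
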